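(* Let $\Gamma\subset\mathbb{R}^2$ be the image of a regular $C^1$ map $\gamma:\mathbb{R}/\mathbb{Z}\to\mathbb{R}^2$. Then for every $\lambda$ with $1/4<\lambda<1/2$, the Minkowski sum $C_\lambda+\Gamma$ has nonempty interior in $\mathbb{R}^2$.
   Context: A $C^1$ map $\gamma:\mathbb{R}/\mathbb{Z}\to\mathbb{R}^2$ is called regular if $\gamma'(t)\ne0$ for every $t\in\mathbb{R}/\mathbb{Z}$. For $0<\lambda<1/2$, $K_\lambda\subset[0,1]$ is the unique nonempty compact set with $K_\lambda=\lambda K_\lambda\cup(\lambda K_\lambda+1-\lambda)$, and $C_\lambda=K_\lambda\times K_\lambda$. The Minkowski sum is $F+\Gamma=\{x+y:x\in F,\ y\in\Gamma\}$. *)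

theory Defs
  imports "HOL-Analysis.Analysis" "HOL-Library.Set_Algebras"
begin

definition is_cantor_attractor :: "real \<Rightarrow> real set \<Rightarrow> bool" where
  "is_cantor_attractor r K \<longleftrightarrow>
     K \<noteq> {} \<and> compact K \<and> K \<subseteq> {0..1} \<and>
     K = (\<lambda>x. r * x) ` K \<union> (\<lambda>x. r * x + 1 - r) ` K"

text \<open>Meaningful for \<open>0 < r < 1/2\<close>: see \<open>ex1_cantor_attractor\<close> below.\<close>

definition cantor_set :: "real \<Rightarrow> real set" where
  "cantor_set r = (THE K. is_cantor_attractor r K)"

definition cantor_square :: "real \<Rightarrow> (real \<times> real) set" where
  "cantor_square r = cantor_set r \<times> cantor_set r"

text \<open>A map on \<open>\<real>/\<int>\<close> is represented by its 1-periodic lift to \<open>\<real>\<close>; the lift has the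
  same derivatives and the same image.\<close>

definition regular_C1_closed_curve :: "(real \<Rightarrow> real \<times> real) \<Rightarrow> bool" where
  "regular_C1_closed_curve \<gamma> \<longleftrightarrow>
     (\<forall>t. \<gamma> (t + 1) = \<gamma> t) \<and>
     \<gamma> C1_differentiable_on UNIV \<and>
     (\<forall>t. vector_derivative \<gamma> (at t) \<noteq> 0)"

lemma cantor_attractor_subset:
  assumes r: "0 < r" "r < 1/2" and K: "is_cantor_attractor r K" and L: "is_cantor_attractor r L"
  shows "K \<subseteq> L"
proof -
  have cK: "compact K" "K \<noteq> {}" and Keq: "K = (\<lambda>x. r * x) ` K \<union> (\<lambda>x. r * x + 1 - r) ` K"
    using K by (auto simp: is_cantor_attractor_def)
  have cL: "compact L" "L \<noteq> {}" and Leq: "L = (\<lambda>x. r * x) ` L \<union> (\<lambda>x. r * x + 1 - r) ` L"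
    using L by (auto simp: is_cantor_attractor_def)
  have "continuous_on K (\<lambda>x. infdist x L)"
    by (intro continuous_intros)
  then obtain x where x: "x \<in> K" "\<And>y. y \<in> K \<Longrightarrow> infdist y L \<le> infdist x L"
    using continuous_attains_sup[OF cK] by blast
  obtain y where y: "y \<in> K" "x = r * y \<or> x = r * y + 1 - r"
    using x(1) Keq by blast
  obtain z where z: "z \<in> L" "infdist y L = dist y z"
    using infdist_attains_inf[of L y] cL compact_imp_closed by blast
  have zz: "r * z \<in> L" "r * z + 1 - r \<in> L" using z(1) Leq by blast+
  have d: "\<bar>r * y - r * z\<bar> = r * dist y z"
    using r by (simp add: dist_real_def abs_mult flip: right_diff_distrib)
  have "infdist x L \<le> r * dist y z"
    using y(2)
  proof
    assume "x = r * y"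
    then show ?thesis using infdist_le[OF zz(1), of x] d by (simp add: dist_real_def)
  next
    assume "x = r * y + 1 - r"
    then show ?thesis using infdist_le[OF zz(2), of x] d by (simp add: dist_real_def)
  qed
  also have "\<dots> \<le> r * infdist x L"
    using x(2)[OF y(1)] z(2) r by simp
  finally have "(1 - r) * infdist x L \<le> 0" by (simp add: algebra_simps)
  then have "infdist x L \<le> 0" using r by (simp add: mult_le_0_iff)
  then have "infdist w L = 0" if "w \<in> K" for w
    using x(2)[OF that] infdist_nonneg[of w L] by linarith
  then show ?thesis
    using in_closed_iff_infdist_zero[of L] cL compact_imp_closed by blast
qed

lemma cantor_attractor_exists:
  assumes r: "0 < r" "r < 1/2"
  shows "\<exists>K. is_cantor_attractor r K"
proof -
  define f g where "f = (\<lambda>x::real. r * x)" and "g = (\<lambda>x::real. r * x + 1 - r)"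
  define F where "F = (\<lambda>A. f ` A \<union> g ` A)"
  define A where "A = (\<lambda>n. (F ^^ n) {0..1})"
  have A0: "A 0 = {0..1}" and AS: "A (Suc n) = F (A n)" for n
    by (simp_all add: A_def)
  have contf: "continuous_on S f" "continuous_on S g" for S
    by (auto simp: f_def g_def intro!: continuous_intros)
  have injf: "inj f" "inj g" using r by (auto simp: f_def g_def inj_on_def)
  have cA: "compact (A n)" for n
    by (induction n) (auto simp: A0 AS F_def intro!: compact_Un compact_continuous_image contf)
  have zA: "0 \<in> A n" for n
    by (induction n) (auto simp: A0 AS F_def f_def)
  have f01: "f x \<in> {0..<1/2}" "g x \<in> {1/2<..1}" if "x \<in> {0..1}" for x
  proof -
    have "r * x \<le> r" "0 \<le> r * x" using that r by (simp_all add: mult_left_le)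
    then have "0 \<le> f x" "f x < 1/2" "1/2 < g x" "g x \<le> 1"
      unfolding f_def g_def using r by linarith+
    then show "f x \<in> {0..<1/2}" "g x \<in> {1/2<..1}" by simp_all
  qed
  have "f x \<in> {0..1}" "g x \<in> {0..1}" if "x \<in> {0..1}" for x
    using f01[OF that] by simp_all
  then have "F {0..1} \<subseteq> {0..1}" unfolding F_def by blast
  moreover have mF: "F S \<subseteq> F T" if "S \<subseteq> T" for S T
    using that by (auto simp: F_def)
  ultimately have dec: "A (Suc n) \<subseteq> A n" for n
    by (induction n) (auto simp: A0 AS dest: mF)
  have decs: "A n \<subseteq> A m" if "m \<le> n" for m n
    using that dec by (rule lift_Suc_antimono_le[rotated])
  define K where "K = (\<Inter>n. A n)"
  have K01: "K \<subseteq> {0..1}" using A0 by (auto simp: K_def)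
  have "K = f ` K \<union> g ` K"
  proof (intro equalityI subsetI)
    fix x assume x: "x \<in> K"
    then have xS: "x \<in> F (A n)" for n unfolding K_def by (metis AS INT_E UNIV_I)
    have sub: "A n \<subseteq> {0..1}" for n using decs[of 0 n] A0 by simp
    show "x \<in> f ` K \<union> g ` K"
    proof (cases "x < 1/2")
      case True
      then have "x \<in> f ` A n" for n
      proof -
        have "x \<notin> g ` A n"
        proof
          assume "x \<in> g ` A n"
          then obtain y where "y \<in> A n" "x = g y" by blast
          then show False using f01(2)[of y] sub[of n] True by auto
        qed
        then show ?thesis using xS[of n] unfolding F_def by blast
      qed
      then have "x \<in> (\<Inter>n. f ` A n)" by blast
      also have "\<dots> = f ` K" unfolding K_def by (simp add: image_INT[OF injf(1)] )
      finally show ?thesis by blast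
    next
      case False
      then have "x \<in> g ` A n" for n
      proof -
        have "x \<notin> f ` A n"
        proof
          assume "x \<in> f ` A n"
          then obtain y where "y \<in> A n" "x = f y" by blast
          then show False using f01(1)[of y] sub[of n] False by auto
        qed
        then show ?thesis using xS[of n] unfolding F_def by blast
      qed
      then have "x \<in> (\<Inter>n. g ` A n)" by blast
      also have "\<dots> = g ` K" unfolding K_def by (simp add: image_INT[OF injf(2)])
      finally show ?thesis by blast
    qed
  next
    fix x assume "x \<in> f ` K \<union> g ` K"
    then have "x \<in> A (Suc n)" for n by (auto simp: AS F_def K_def)
    then have "x \<in> A n" for n using dec by blast
    then show "x \<in> K" by (simp add: K_def)
  qed
  moreover have "0 \<in> K" by (simp add: K_def zA)
  moreover have "compact K" unfolding K_def using cA by (intro compact_Inter) auto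
  ultimately have "is_cantor_attractor r K"
    using K01 by (auto simp: is_cantor_attractor_def f_def g_def)
  then show ?thesis ..
qed

lemma ex1_cantor_attractor:
  assumes "0 < r" "r < 1/2"
  shows "\<exists>!K. is_cantor_attractor r K"
  using cantor_attractor_exists[OF assms] cantor_attractor_subset[OF assms]
  by (metis subset_antisym)

lemma cantor_set_attractor:
  assumes "0 < r" "r < 1/2"
  shows "is_cantor_attractor r (cantor_set r)"
  unfolding cantor_set_def by (rule theI') (rule ex1_cantor_attractor[OF assms])

end

theory Submission imports Defs begin

text \<open>
  The proof rests on one exceptional projection. Under \<open>(x, y) \<mapsto> x + 2 * y\<close> the four corner
  subsquares of the unit square, of side \<open>r\<close>, project to intervals of length \<open>3 * r\<close> whose left
  endpoints are \<open>0, 1 - r, 2 * (1 - r), 3 * (1 - r)\<close>. For \<open>r = 1/4\<close> these tile \<open>[0, 3]\<close>; for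
  \<open>r > 1/4\<close> neighbours overlap by a definite amount, so the covering survives a small
  perturbation. Hence a curve that follows the fibre direction \<open>(-2, 1)\<close> up to a small relative
  error and crosses a square of the Cantor construction with some room to spare also crosses,
  with the same relative room, one of its four children
  (\<open>crossing_passes_to_a_child\<close>). Iterating, it comes arbitrarily close to the compact
  Cantor square, hence meets it (\<open>nearly_fibred_curve_meets_cantor_square\<close>).

  A closed curve has a tangent in every direction: Rolle's theorem for the function \<open>x + 2 * y\<close>
  along the curve produces a point whose tangent is parallel to \<open>(-2, 1)\<close>, and regularity makes a
  neighbourhood of it a graph over the \<open>y\<close>-axis on which \<open>x + 2 * y\<close> has an arbitrarily small
  Lipschitz constant (\<open>closed_curve_contains_nearly_fibred_graph\<close>). Finally \<open>p\<close> lies in the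
  Minkowski sum as soon as the reflected arc \<open>p - \<Gamma>\<close> meets the Cantor square. The slopes of
  \<open>p - \<Gamma>\<close> are those of \<open>\<Gamma>\<close>, and crossing a fixed small corner square with room to spare is an
  open condition on \<open>p\<close>.
\<close>

section \<open>Squares of the Cantor construction\<close>

text \<open>The position of a level-\<open>n\<close> square is recorded through its two coordinates; each
  satisfies this predicate, which avoids digit expansions.\<close>

definition cell_corner :: "real \<Rightarrow> nat \<Rightarrow> real \<Rightarrow> bool" where
  "cell_corner r n a \<longleftrightarrow> (\<forall>x \<in> cantor_set r. a + r ^ n * x \<in> cantor_set r)"

context
  fixes r :: real
  assumes r: "0 < r" "r < 1/2"
begin

lemma compact_cantor_set: "compact (cantor_set r)"
  using cantor_set_attractor[OF r] by (simp add: is_cantor_attractor_def)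

lemma cantor_set_maps:
  assumes "x \<in> cantor_set r"
  shows "r * x \<in> cantor_set r" "r * x + 1 - r \<in> cantor_set r"
  using cantor_set_attractor[OF r] assms unfolding is_cantor_attractor_def by blast+

lemma zero_in_cantor_set: "0 \<in> cantor_set r"
proof -
  have ne: "cantor_set r \<noteq> {}" and ge: "\<And>x. x \<in> cantor_set r \<Longrightarrow> 0 \<le> x"
    using cantor_set_attractor[OF r] by (auto simp: is_cantor_attractor_def)
  obtain x where x: "x \<in> cantor_set r" "\<And>y. y \<in> cantor_set r \<Longrightarrow> x \<le> y"
    using compact_attains_inf[OF compact_cantor_set ne] by blast
  have "x \<le> r * x" using x cantor_set_maps by blast
  then have "(1 - r) * x \<le> 0" by (simp add: algebra_simps)
  then have "x \<le> 0" using r by (simp add: mult_le_0_iff)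
  then show ?thesis using ge[OF x(1)] x(1) by simp
qed

lemma cell_corner_mem: "cell_corner r n a \<Longrightarrow> a \<in> cantor_set r"
  using zero_in_cantor_set unfolding cell_corner_def by force

lemma cell_corner_zero: "cell_corner r n 0"
proof (induction n)
  case (Suc n)
  then show ?case
    using cantor_set_maps(1) by (fastforce simp: cell_corner_def mult.assoc)
qed (simp add: cell_corner_def)

lemma cell_corner_child:
  assumes "cell_corner r n a" "i \<in> {0, 1}"
  shows "cell_corner r (Suc n) (a + i * (1 - r) * r ^ n)"
  unfolding cell_corner_def
proof
  fix x assume x: "x \<in> cantor_set r"
  have "r * x + i * (1 - r) \<in> cantor_set r"
    using cantor_set_maps[OF x] assms(2) by (auto simp: algebra_simps)
  then have "a + r ^ n * (r * x + i * (1 - r)) \<in> cantor_set r"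
    using assms(1) by (simp add: cell_corner_def)
  then show "a + i * (1 - r) * r ^ n + r ^ Suc n * x \<in> cantor_set r"
    by (simp add: algebra_simps)
qed

end

section \<open>Curves close to the exceptional direction\<close>

text \<open>The four intervals \<open>[(1 - r) * d, (1 - r) * d + 3 * r]\<close>, \<open>d = i + 2 * j\<close>, still cover after
  each is shrunk at both ends by \<open>\<delta> * r + \<delta> / 2\<close>: consecutive ones overlap by
  \<open>4 * r - 1 = 4 * \<delta>\<close>, and the shrinking costs at most \<open>2 * \<delta>\<close>. At the
  two outer ends it costs at most \<open>\<delta>\<close>, which is why \<open>w\<close> keeps that distance from \<open>0\<close> and \<open>3\<close>.\<close>

lemma shrunk_child_intervals_cover:
  fixes r \<delta> w :: real
  assumes r: "1/4 < r" "r < 1/2" and \<delta>: "\<delta> = (4 * r - 1) / 4"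
    and w: "\<delta> \<le> w" "w \<le> 3 - \<delta>"
  shows "\<exists>i\<in>{0,1}. \<exists>j\<in>{0,1}. \<delta> * r + \<delta> / 2 \<le> w - (i + 2 * j) * (1 - r) \<and>
           w - (i + 2 * j) * (1 - r) \<le> (3 - \<delta>) * r - \<delta> / 2"
proof -
  define e where "e = \<delta> * r"
  have e: "e \<le> \<delta> / 2" "0 \<le> e" using r \<delta> by (simp_all add: e_def)
  have expand: "(3 - \<delta>) * r = 3 * r - e" by (simp add: e_def algebra_simps)
  have r4: "4 * r = 1 + 4 * \<delta>" using \<delta> by simp
  consider "w \<le> 3 * r - e - \<delta> / 2"
    | "3 * r - e - \<delta> / 2 < w" "w \<le> (1 - r) + 3 * r - e - \<delta> / 2"
    | "(1 - r) + 3 * r - e - \<delta> / 2 < w" "w \<le> 2 * (1 - r) + 3 * r - e - \<delta> / 2"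
    | "2 * (1 - r) + 3 * r - e - \<delta> / 2 < w" by linarith
  then show ?thesis
  proof cases
    case 1 then show ?thesis unfolding expand e_def[symmetric] using e w
      by (intro bexI[of _ 0]) auto
  next
    case 2 then show ?thesis unfolding expand e_def[symmetric] using e w r4
      by (intro bexI[of _ 1] bexI[of _ 0]) auto
  next
    case 3 then show ?thesis unfolding expand e_def[symmetric] using e w r4
      by (intro bexI[of _ 0] bexI[of _ 1]) auto
  next
    case 4 then show ?thesis unfolding expand e_def[symmetric] using e w r4
      by (intro bexI[of _ 1]) auto
  qed
qed

text \<open>The curve is \<open>{(k y - 2 * y, y)}\<close>, so \<open>k\<close> is its exceptional projection at height \<open>y\<close>.
  It crosses the square at \<open>(a, b)\<close> of side \<open>s\<close> with room to spare if, relative to \<open>a + 2 * b\<close>,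
  the value \<open>k b\<close> lies in \<open>[\<delta> * s, (3 - \<delta>) * s]\<close>. Passing to the bottom of a child moves \<open>k\<close> by
  at most \<open>\<delta> / 2 * s\<close>, which the covering absorbs.\<close>

lemma crossing_passes_to_a_child:
  fixes k :: "real \<Rightarrow> real"
  assumes r: "1/4 < r" "r < 1/2" and \<delta>: "\<delta> = (4 * r - 1) / 4"
    and s: "0 < s" and lip: "(\<delta> / 2)-lipschitz_on {b..b + s} k"
    and cross: "\<delta> * s \<le> k b - (a + 2 * b)" "k b - (a + 2 * b) \<le> (3 - \<delta>) * s"
  obtains i j where "i \<in> {0,1}" "j \<in> {0,1}"
    "\<delta> * (r * s) \<le> k (b + j * (1 - r) * s) - ((a + i * (1 - r) * s) + 2 * (b + j * (1 - r) * s))"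
    "k (b + j * (1 - r) * s) - ((a + i * (1 - r) * s) + 2 * (b + j * (1 - r) * s)) \<le> (3 - \<delta>) * (r * s)"
proof -
  define w where "w = (k b - (a + 2 * b)) / s"
  have ws: "k b = a + 2 * b + w * s" using s by (simp add: w_def)
  have "\<delta> \<le> w" "w \<le> 3 - \<delta>" using cross s by (simp_all add: w_def field_simps)
  from shrunk_child_intervals_cover[OF r \<delta> this] obtain i j :: real
    where ij: "i \<in> {0,1}" "j \<in> {0,1}"
      and lo: "\<delta> * r + \<delta> / 2 \<le> w - (i + 2 * j) * (1 - r)"
      and hi: "w - (i + 2 * j) * (1 - r) \<le> (3 - \<delta>) * r - \<delta> / 2"
    by blast
  define b' where "b' = b + j * (1 - r) * s"
  have b': "b \<le> b'" "b' \<le> b + s" using ij(2) r s by (auto simp: b'_def)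
  have "\<bar>k b' - k b\<bar> \<le> \<delta> / 2 * \<bar>b' - b\<bar>"
    using lipschitz_onD[OF lip, of b' b] b' s by (simp add: dist_real_def)
  also have "\<dots> \<le> \<delta> / 2 * s"
    using b' r \<delta> by (intro mult_left_mono) auto
  finally have move: "\<bar>k b' - k b\<bar> \<le> \<delta> / 2 * s" .
  have lo': "\<delta> * (r * s) + \<delta> / 2 * s \<le> (w - (i + 2 * j) * (1 - r)) * s"
    using mult_right_mono[OF lo, of s] s unfolding distrib_right[of "\<delta> * r"] mult.assoc by simp
  have hi': "(w - (i + 2 * j) * (1 - r)) * s \<le> (3 - \<delta>) * (r * s) - \<delta> / 2 * s"
    using mult_right_mono[OF hi, of s] s
    unfolding left_diff_distrib[of "(3 - \<delta>) * r"] mult.assoc by simp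
  have shift: "k b' - ((a + i * (1 - r) * s) + 2 * b') =
      (w - (i + 2 * j) * (1 - r)) * s + (k b' - k b)"
    by (simp add: ws b'_def algebra_simps)
  have "\<delta> * (r * s) \<le> k b' - ((a + i * (1 - r) * s) + 2 * b')"
    using lo' move unfolding shift by linarith
  moreover have "k b' - ((a + i * (1 - r) * s) + 2 * b') \<le> (3 - \<delta>) * (r * s)"
    using hi' move unfolding shift by linarith
  ultimately show ?thesis using that[OF ij] by (simp add: b'_def)
qed

text \<open>The corners of the successive crossed squares are points of the Cantor square whose
  exceptional projections approach the curve, so by compactness the distance \<open>0\<close> is attained.\<close>

lemma nearly_fibred_curve_meets_cantor_square:
  fixes k :: "real \<Rightarrow> real"
  assumes r: "1/4 < r" "r < 1/2" and \<delta>: "\<delta> = (4 * r - 1) / 4"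
    and lip: "(\<delta> / 2)-lipschitz_on {0..r ^ N} k"
    and cross: "\<delta> * r ^ N \<le> k 0" "k 0 \<le> (3 - \<delta>) * r ^ N"
  obtains a b where "(a, b) \<in> cantor_square r" "b \<in> {0..r ^ N}" "a + 2 * b = k b"
proof -
  have r': "0 < r" using r by simp
  have \<delta>0: "0 < \<delta>" using r \<delta> by simp
  have approx: "\<exists>a b. cell_corner r (N + n) a \<and> cell_corner r (N + n) b \<and>
      0 \<le> b \<and> b + r ^ (N + n) \<le> r ^ N \<and>
      \<delta> * r ^ (N + n) \<le> k b - (a + 2 * b) \<and> k b - (a + 2 * b) \<le> (3 - \<delta>) * r ^ (N + n)" for n
  proof (induction n)
    case 0
    then show ?case
      using cross cell_corner_zero[OF r' r(2)] by (intro exI[of _ 0]) simp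
  next
    case (Suc n)
    define s where "s = r ^ (N + n)"
    have s: "0 < s" using r' by (simp add: s_def)
    from Suc obtain a b where ab: "cell_corner r (N + n) a" "cell_corner r (N + n) b"
        "0 \<le> b" "b + s \<le> r ^ N"
        "\<delta> * s \<le> k b - (a + 2 * b)" "k b - (a + 2 * b) \<le> (3 - \<delta>) * s"
      unfolding s_def by blast
    have "(\<delta> / 2)-lipschitz_on {b..b + s} k"
      using lipschitz_on_subset[OF lip] ab(3,4) by auto
    from crossing_passes_to_a_child[OF r \<delta> s this ab(5,6)] obtain i j where ij: "i \<in> {0,1}" "j \<in> {0,1}"
      and c: "\<delta> * (r * s) \<le> k (b + j * (1 - r) * s) - ((a + i * (1 - r) * s) + 2 * (b + j * (1 - r) * s))"
        "k (b + j * (1 - r) * s) - ((a + i * (1 - r) * s) + 2 * (b + j * (1 - r) * s)) \<le> (3 - \<delta>) * (r * s)"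
      by blast
    have "b + j * (1 - r) * s + r * s \<le> b + s" "0 \<le> j * (1 - r) * s"
      using ij(2) s r by (auto simp: algebra_simps)
    then have "0 \<le> b + j * (1 - r) * s" "b + j * (1 - r) * s + r * s \<le> r ^ N"
      using ab(3,4) by linarith+
    moreover have "r ^ (N + Suc n) = r * s" by (simp add: s_def)
    moreover have "cell_corner r (N + Suc n) (a + i * (1 - r) * s)"
      "cell_corner r (N + Suc n) (b + j * (1 - r) * s)"
      using cell_corner_child[OF r' r(2) ab(1) ij(1)] cell_corner_child[OF r' r(2) ab(2) ij(2)]
      by (simp_all add: s_def)
    ultimately show ?case using c by metis
  qed
  define K where "K = cantor_set r"
  define S where "S = K \<times> (K \<inter> {0..r ^ N})"
  have near: "\<exists>p\<in>S. \<bar>k (snd p) - (fst p + 2 * snd p)\<bar> \<le> 3 * r ^ (N + n)" for n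
  proof -
    obtain a b where ab: "cell_corner r (N + n) a" "cell_corner r (N + n) b"
        "0 \<le> b" "b + r ^ (N + n) \<le> r ^ N"
        "\<delta> * r ^ (N + n) \<le> k b - (a + 2 * b)" "k b - (a + 2 * b) \<le> (3 - \<delta>) * r ^ (N + n)"
      using approx by blast
    have pos: "0 < r ^ (N + n)" using r' by simp
    then have "0 \<le> \<delta> * r ^ (N + n)" using \<delta>0 by simp
    then have "\<bar>k b - (a + 2 * b)\<bar> \<le> 3 * r ^ (N + n)"
      using ab(5,6) unfolding left_diff_distrib by linarith
    moreover have "(a, b) \<in> S"
      using ab pos cell_corner_mem[OF r' r(2)] by (auto simp: S_def K_def)
    ultimately show ?thesis by force
  qed
  have "compact S"
    unfolding S_def K_def using compact_cantor_set[OF r' r(2)]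
    by (intro compact_Times compact_Int_closed) auto
  moreover have "S \<noteq> {}" using near by blast
  moreover have "continuous_on S (\<lambda>p. \<bar>k (snd p) - (fst p + 2 * snd p)\<bar>)"
  proof -
    have "continuous_on S (\<lambda>p. k (snd p))"
      by (rule continuous_on_compose2[OF lipschitz_on_continuous_on[OF lip]])
        (auto simp: S_def intro!: continuous_intros)
    then show ?thesis by (intro continuous_intros)
  qed
  ultimately have "\<exists>p\<in>S. \<forall>q\<in>S.
      \<bar>k (snd p) - (fst p + 2 * snd p)\<bar> \<le> \<bar>k (snd q) - (fst q + 2 * snd q)\<bar>"
    by (rule continuous_attains_inf)
  then obtain p where p: "p \<in> S"
    and least: "\<And>q. q \<in> S \<Longrightarrow>
      \<bar>k (snd p) - (fst p + 2 * snd p)\<bar> \<le> \<bar>k (snd q) - (fst q + 2 * snd q)\<bar>"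
    by blast
  have lim: "(\<lambda>n. 3 * r ^ (N + n)) \<longlonglongrightarrow> 3 * (r ^ N * 0)"
    unfolding power_add using r r' by (intro tendsto_intros LIMSEQ_power_zero) auto
  have "\<bar>k (snd p) - (fst p + 2 * snd p)\<bar> \<le> 3 * r ^ (N + n)" for n
    using near[of n] least by fastforce
  then have "\<bar>k (snd p) - (fst p + 2 * snd p)\<bar> \<le> 3 * (r ^ N * 0)"
    by (intro LIMSEQ_le_const[OF lim]) blast
  then have "fst p + 2 * snd p = k (snd p)" by simp
  moreover have "(fst p, snd p) \<in> cantor_square r" "snd p \<in> {0..r ^ N}"
    using p by (simp_all add: S_def K_def cantor_square_def mem_Times_iff)
  ultimately show ?thesis using that by blast
qed

section \<open>An arc in the exceptional direction\<close>

lemma vanishing_derivative_between_equal_values: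
  fixes F F' :: "real \<Rightarrow> real"
  assumes F: "\<And>t. (F has_real_derivative F' t) (at t)" and "a < b" "F a = F b"
  obtains z where "a < z" "z < b" "F' z = 0"
proof -
  have "continuous_on {a..b} F"
    using DERIV_isCont[OF F] by (auto intro: continuous_at_imp_continuous_on)
  then obtain z where z: "a < z" "z < b" "(F has_real_derivative 0) (at z)"
    using Rolle[OF assms(2,3)] real_differentiable_def F by blast
  show ?thesis using that z(1,2) DERIV_unique[OF F z(3)] by blast
qed

text \<open>Domination of \<open>F'\<close> by a function \<open>G'\<close> of constant sign \<open>\<sigma>\<close> integrates to a Lipschitz
  bound for \<open>F\<close> in terms of \<open>G\<close>, because \<open>\<epsilon> * \<sigma> * G + F\<close> and \<open>\<epsilon> * \<sigma> * G - F\<close> are both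
  nondecreasing.\<close>

lemma increments_dominated:
  fixes F G F' G' :: "real \<Rightarrow> real"
  assumes F: "\<And>t. (F has_real_derivative F' t) (at t)"
    and G: "\<And>t. (G has_real_derivative G' t) (at t)"
    and dom: "\<And>t. t \<in> {a..b} \<Longrightarrow> \<bar>F' t\<bar> \<le> \<epsilon> * (\<sigma> * G' t)"
    and tu: "a \<le> u" "u \<le> t" "t \<le> b"
  shows "\<bar>F t - F u\<bar> \<le> \<epsilon> * (\<sigma> * (G t - G u))"
proof -
  have "\<epsilon> * (\<sigma> * G u) + F u \<le> \<epsilon> * (\<sigma> * G t) + F t"
  proof (rule DERIV_nonneg_imp_nondecreasing[OF tu(2)])
    fix x assume "u \<le> x" "x \<le> t"
    then have "0 \<le> \<epsilon> * (\<sigma> * G' x) + F' x" using dom[of x] tu by auto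
    then show "\<exists>y. ((\<lambda>x. \<epsilon> * (\<sigma> * G x) + F x) has_real_derivative y) (at x) \<and> 0 \<le> y"
      by (intro exI[of _ "\<epsilon> * (\<sigma> * G' x) + F' x"] conjI DERIV_add DERIV_cmult F G)
  qed
  moreover have "\<epsilon> * (\<sigma> * G u) - F u \<le> \<epsilon> * (\<sigma> * G t) - F t"
  proof (rule DERIV_nonneg_imp_nondecreasing[OF tu(2)])
    fix x assume "u \<le> x" "x \<le> t"
    then have "0 \<le> \<epsilon> * (\<sigma> * G' x) - F' x" using dom[of x] tu by auto
    then show "\<exists>y. ((\<lambda>x. \<epsilon> * (\<sigma> * G x) - F x) has_real_derivative y) (at x) \<and> 0 \<le> y"
      by (intro exI[of _ "\<epsilon> * (\<sigma> * G' x) - F' x"] conjI DERIV_diff DERIV_cmult F G)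
  qed
  ultimately show ?thesis by (simp add: algebra_simps abs_le_iff)
qed

text \<open>At a zero \<open>t\<^sub>0\<close> of \<open>F'\<close> with \<open>G' t\<^sub>0 \<noteq> 0\<close>, the curve \<open>(F, G)\<close> is locally a graph over
  its second coordinate with small slopes. The graph is obtained from the intermediate value
  theorem by choosing parameters; no inverse function is needed.\<close>

lemma flat_graph_at_critical_point:
  fixes F G F' G' :: "real \<Rightarrow> real"
  assumes F: "\<And>t. (F has_real_derivative F' t) (at t)"
    and G: "\<And>t. (G has_real_derivative G' t) (at t)"
    and cont: "continuous_on UNIV F'" "continuous_on UNIV G'"
    and crit: "F' t\<^sub>0 = 0" "G' t\<^sub>0 \<noteq> 0" and \<epsilon>: "0 < \<epsilon>"
  obtains l u \<phi> where "l < u" "\<epsilon>-lipschitz_on {l..u} \<phi>"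
    "\<And>y. y \<in> {l..u} \<Longrightarrow> \<exists>t. F t = \<phi> y \<and> G t = y"
proof -
  define \<sigma> where "\<sigma> = sgn (G' t\<^sub>0)"
  define H where "H = (\<lambda>t. \<epsilon> * (\<sigma> * G' t) - \<bar>F' t\<bar>)"
  have "isCont H t\<^sub>0"
    unfolding H_def
    using cont by (auto simp: continuous_on_eq_continuous_at intro!: continuous_intros)
  moreover have "0 < H t\<^sub>0"
    using crit \<epsilon> by (simp add: H_def \<sigma>_def sgn_mult_self_eq sgn_if)
  ultimately have "\<forall>\<^sub>F t in nhds t\<^sub>0. 0 < H t"
    unfolding continuous_within tendsto_at_iff_tendsto_nhds by (rule order_tendstoD)
  then obtain d where d: "0 < d" "\<And>t. \<bar>t - t\<^sub>0\<bar> < d \<Longrightarrow> \<bar>F' t\<bar> < \<epsilon> * (\<sigma> * G' t)"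
    unfolding eventually_nhds_metric by (auto simp: H_def dist_real_def)
  define a b where "a = t\<^sub>0 - d / 2" and "b = t\<^sub>0 + d / 2"
  have ab: "a < b" using d by (simp add: a_def b_def)
  have dom: "\<bar>F' t\<bar> < \<epsilon> * (\<sigma> * G' t)" if "t \<in> {a..b}" for t
    using that d by (auto simp: a_def b_def)
  have Lip: "\<bar>F t - F u\<bar> \<le> \<epsilon> * \<bar>G t - G u\<bar>" if "t \<in> {a..b}" "u \<in> {a..b}" for t u
  proof -
    have *: "\<bar>F t - F u\<bar> \<le> \<epsilon> * \<bar>G t - G u\<bar>" if "a \<le> u" "u \<le> t" "t \<le> b" for t u
    proof -
      have "\<bar>F t - F u\<bar> \<le> \<epsilon> * (\<sigma> * (G t - G u))"
        by (rule increments_dominated[OF F G less_imp_le[OF dom] that]) simp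
      also have "\<dots> \<le> \<epsilon> * \<bar>G t - G u\<bar>"
        using \<epsilon> by (intro mult_left_mono) (auto simp: \<sigma>_def sgn_if)
      finally show ?thesis .
    qed
    show ?thesis
      using *[of u t] *[of t u] that by (cases "u \<le> t") (auto simp: abs_minus_commute)
  qed
  have "G a \<noteq> G b"
  proof
    assume "G a = G b"
    then obtain z where "a < z" "z < b" "G' z = 0"
      using vanishing_derivative_between_equal_values[OF G ab] by blast
    then show False using dom[of z] by simp
  qed
  define l u where "l = min (G a) (G b)" and "u = max (G a) (G b)"
  have "\<exists>t\<in>{a..b}. G t = y" if "y \<in> {l..u}" for y
  proof -
    have cG: "continuous_on {a..b} G"
      using G by (meson DERIV_continuous_on has_field_derivative_at_within)
    show ?thesis
    proof (cases "G a \<le> G b")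
      case True
      then show ?thesis using IVT'[OF _ _ _ cG, of y] that ab by (auto simp: l_def u_def)
    next
      case False
      then show ?thesis using IVT2'[OF _ _ _ cG, of y] that ab by (auto simp: l_def u_def)
    qed
  qed
  then obtain \<tau> where \<tau>: "\<And>y. y \<in> {l..u} \<Longrightarrow> \<tau> y \<in> {a..b} \<and> G (\<tau> y) = y"
    by metis
  show ?thesis
  proof (rule that[of l u "\<lambda>y. F (\<tau> y)"])
    show "l < u" using \<open>G a \<noteq> G b\<close> by (auto simp: l_def u_def)
    show "\<epsilon>-lipschitz_on {l..u} (\<lambda>y. F (\<tau> y))"
      using \<epsilon> Lip \<tau> by (intro lipschitz_onI) (metis dist_real_def, simp)
    show "\<exists>t. F t = F (\<tau> y) \<and> G t = y" if "y \<in> {l..u}" for y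
      using \<tau>[OF that] by blast
  qed
qed

text \<open>Rolle's theorem applies to \<open>F = x + 2 * y\<close> because the curve closes up; regularity then
  forces \<open>y' \<noteq> 0\<close> at the critical point.\<close>

lemma closed_curve_contains_nearly_fibred_graph:
  assumes \<gamma>: "regular_C1_closed_curve \<gamma>" and \<epsilon>: "0 < \<epsilon>"
  obtains l u \<phi> where "l < u" "\<epsilon>-lipschitz_on {l..u} \<phi>"
    "\<And>y. y \<in> {l..u} \<Longrightarrow> (\<phi> y - 2 * y, y) \<in> range \<gamma>"
proof -
  obtain D where D: "\<And>t. (\<gamma> has_vector_derivative D t) (at t)" and contD: "continuous_on UNIV D"
    using \<gamma> unfolding regular_C1_closed_curve_def C1_differentiable_on_def by auto
  have D0: "D t \<noteq> 0" for t
    using \<gamma> D vector_derivative_at unfolding regular_C1_closed_curve_def by metis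
  define F G where "F = (\<lambda>t. fst (\<gamma> t) + 2 * snd (\<gamma> t))" and "G = (\<lambda>t. snd (\<gamma> t))"
  define F' G' where "F' = (\<lambda>t. fst (D t) + 2 * snd (D t))" and "G' = (\<lambda>t. snd (D t))"
  have dfst: "((\<lambda>t. fst (\<gamma> t)) has_real_derivative fst (D t)) (at t)"
    and dsnd: "((\<lambda>t. snd (\<gamma> t)) has_real_derivative snd (D t)) (at t)" for t
    unfolding has_real_derivative_iff_has_vector_derivative
    using bounded_linear.has_vector_derivative[OF bounded_linear_fst D]
      bounded_linear.has_vector_derivative[OF bounded_linear_snd D] by simp_all
  have dF: "(F has_real_derivative F' t) (at t)" and dG: "(G has_real_derivative G' t) (at t)" for t
    unfolding F_def F'_def G_def G'_def by (intro DERIV_add DERIV_cmult dfst dsnd)+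
  have cont: "continuous_on UNIV F'" "continuous_on UNIV G'"
    unfolding F'_def G'_def by (intro continuous_intros contD)+
  have "\<gamma> (0 + 1) = \<gamma> 0" using \<gamma> unfolding regular_C1_closed_curve_def by blast
  then have "F 0 = F 1" by (simp add: F_def)
  then obtain t\<^sub>0 where t\<^sub>0: "F' t\<^sub>0 = 0"
    using vanishing_derivative_between_equal_values[OF dF zero_less_one] by blast
  have "G' t\<^sub>0 \<noteq> 0"
    using t\<^sub>0 D0[of t\<^sub>0] by (auto simp: F'_def G'_def prod_eq_iff)
  then obtain l u \<phi> where g: "l < u" "\<epsilon>-lipschitz_on {l..u} \<phi>"
    "\<And>y. y \<in> {l..u} \<Longrightarrow> \<exists>t. F t = \<phi> y \<and> G t = y"
    using flat_graph_at_critical_point[OF dF dG cont t\<^sub>0 _ \<epsilon>] by metis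
  have "(\<phi> y - 2 * y, y) \<in> range \<gamma>" if y: "y \<in> {l..u}" for y
  proof -
    obtain t where "F t = \<phi> y" "G t = y" using g(3)[OF y] by blast
    then have "\<gamma> t = (\<phi> y - 2 * y, y)" by (auto simp: F_def G_def prod_eq_iff)
    then show ?thesis by (metis rangeI)
  qed
  then show ?thesis using that g by blast
qed

section \<open>Interior of the Minkowski sum\<close>

theorem corollary6p2:
  fixes \<gamma> :: "real \<Rightarrow> real \<times> real" and \<Gamma> :: "(real \<times> real) set"
  assumes "regular_C1_closed_curve \<gamma>"
    and "\<Gamma> = range \<gamma>"
  shows "\<forall>r::real. 1/4 < r \<and> r < 1/2 \<longrightarrow> interior (cantor_square r + \<Gamma>) \<noteq> {}"
proof (intro allI impI, elim conjE)
  fix r :: real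
  assume r: "1/4 < r" "r < 1/2"
  define \<delta> where "\<delta> = (4 * r - 1) / 4"
  have \<delta>: "0 < \<delta>" "0 < \<delta> / 2" "\<delta> \<le> 1/4" using r by (simp_all add: \<delta>_def)
  obtain l u \<phi> where lu: "l < u" and lip: "(\<delta> / 2)-lipschitz_on {l..u} \<phi>"
    and graph: "\<And>y. y \<in> {l..u} \<Longrightarrow> (\<phi> y - 2 * y, y) \<in> range \<gamma>"
    using closed_curve_contains_nearly_fibred_graph[OF assms(1) \<delta>(2)] by blast
  obtain N where "r ^ N < u - l"
    using real_arch_pow_inv[of "u - l" r] lu r by auto
  define s where "s = r ^ N"
  have s: "0 < s" "l + s < u" using r \<open>r ^ N < u - l\<close> by (simp_all add: s_def)
  define m where "m = (l + s + u) / 2"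
  have m: "l + s < m" "m < u" using s by (simp_all add: m_def)
  (* The reflected arc p - \<Gamma> is to cross the corner square [0, s] x [0, s]: its lower edge must be
     hit near the middle 3/2 * s of the admissible range, at a height where the arc spans the
     whole square. Replacing \<phi> (snd p) by the constant \<phi> m makes the condition visibly open; the
     error is at most s / 8, and s + s / 8 is less than (3/2 - \<delta>) * s. *)
  define U where "U = {p :: real \<times> real. (l + s < snd p \<and> snd p < u) \<and> \<bar>snd p - m\<bar> < s \<and>
    \<bar>fst p + 2 * snd p - \<phi> m - 3/2 * s\<bar> < s}"
  have "open U"
    unfolding U_def by (intro open_Collect_conj open_Collect_less continuous_intros)
  moreover have "(\<phi> m + 3/2 * s - 2 * m, m) \<in> U"
    using m s by (simp add: U_def)
  moreover have "U \<subseteq> cantor_square r + \<Gamma>"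
  proof
    fix p assume p: "p \<in> U"
    define k where "k = (\<lambda>y. fst p + 2 * snd p - \<phi> (snd p - y))"
    have sub: "snd p - y \<in> {l..u}" if "y \<in> {0..s}" for y
      using p that by (auto simp: U_def)
    have lipk: "(\<delta> / 2)-lipschitz_on {0..s} k"
    proof (rule lipschitz_onI)
      fix x y assume "x \<in> {0..s}" "y \<in> {0..s}"
      then show "dist (k x) (k y) \<le> \<delta> / 2 * dist x y"
        using lipschitz_onD[OF lip sub sub, of x y]
        by (simp add: k_def dist_real_def abs_minus_commute)
    qed (use \<delta> in simp)
    have "\<bar>\<phi> (snd p) - \<phi> m\<bar> \<le> \<delta> / 2 * \<bar>snd p - m\<bar>"
      using lipschitz_onD[OF lip, of "snd p" m] p m s by (auto simp: U_def dist_real_def)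
    also have "\<dots> \<le> 1/8 * s"
      using p \<delta> s by (intro mult_mono) (auto simp: U_def)
    finally have "\<bar>\<phi> (snd p) - \<phi> m\<bar> \<le> 1/8 * s" .
    moreover have "\<bar>fst p + 2 * snd p - \<phi> m - 3/2 * s\<bar> < s" using p by (simp add: U_def)
    moreover have "k 0 = fst p + 2 * snd p - \<phi> (snd p)" by (simp add: k_def)
    moreover have "\<delta> * s \<le> 1/4 * s" using \<delta> s by (intro mult_right_mono) auto
    ultimately have "\<delta> * s \<le> k 0" "k 0 \<le> (3 - \<delta>) * s"
      unfolding left_diff_distrib by linarith+
    then obtain a b where ab: "(a, b) \<in> cantor_square r" "b \<in> {0..s}" "a + 2 * b = k b"
      using nearly_fibred_curve_meets_cantor_square[OF r \<delta>_def, of N k] lipk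
      unfolding s_def by blast
    have "(\<phi> (snd p - b) - 2 * (snd p - b), snd p - b) \<in> \<Gamma>"
      using graph[OF sub[OF ab(2)]] assms(2) by simp
    moreover have "p = (a, b) + (\<phi> (snd p - b) - 2 * (snd p - b), snd p - b)"
      using ab(3) by (simp add: k_def prod_eq_iff)
    ultimately show "p \<in> cantor_square r + \<Gamma>"
      using ab(1) by (metis set_plus_intro)
  qed
  ultimately show "interior (cantor_square r + \<Gamma>) \<noteq> {}"
    using interior_maximal by blast
qed

end
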